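(* Let $X$ and $Y$ be triangular $\mathbb{Z}^2$-subshifts with nontrivial entropy norms, and assume both are polygonal with respect to the same rational triangle $\mathcal{T}$. Then there is a constant $c>0$ such that $\|v\|_X=c\,\|v\|_Y$ for all $v\in\mathbb{R}^2$.
   Context: For a finite alphabet $\mathcal{A}$ (discrete topology), a $\mathbb{Z}^2$-subshift is a closed subset $X\subset\mathcal{A}^{\mathbb{Z}^2}$ (product topology) invariant under the shifts $(T^ux)(v)=x(u+v)$, $u\in\mathbb{Z}^2$. The alphabets of $X$ and $Y$ may differ. For $A,B\subset\mathbb{R}^2$, $A$ $X$-codes $B$ if whenever $x,x'\in X$ agree on $A\cap\mathbb{Z}^2$ they agree on $B\cap\mathbb{Z}^2$. A convex polygon $\mathcal{P}$ (including its interior) with all vertices in $\mathbb{Z}^2$ is a coding polygon for an infinite $\mathbb{Z}^2$-subshift $X$, and $X$ is polygonal with respect to $\mathcal{P}$, if for every vertex $v$ of $\mathcal{P}$, $\mathcal{P}\setminus\{v\}$ $X$-codes $\{v\}$. $X$ is triangular if it has a coding polygon that is a triangle (with vertices in $\mathbb{Z}^2$; in particular the sides have rational slopes, whence "rational triangle"). For $\mathcal{S}\subset\mathbb{R}^2$ let $P(X,\mathcal{S})$ be the number of distinct restrictions of elements of $X$ to $\mathcal{S}\cap\mathbb{Z}^2$. For a (possibly degenerate) polygon $\mathcal{P}\subset\mathbb{R}^2$ and $r>0$ let $\mathcal{P}_r=\{u\in\mathbb{Z}^2: d(u,\mathcal{P})<r\}$, with $d$ Euclidean distance, and $$\mathcal{H}(X,\mathcal{P})=\lim_{r\to\infty}\lim_{n\to\infty}\frac{\ln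 P(X,(n\mathcal{P})_r)}{n}.$$ For $v\in\mathbb{R}^2$ let $I_v=\{tv: t\in[0,1]\}$. The directional entropy is $h_v(X)=\mathcal{H}(X,I_v)$, and the entropy seminorm of $X$ is $\|v\|_X=h_v(X)$; it is nontrivial if it is not identically zero. *)

theory Defs
  imports "HOL-Analysis.Analysis"
begin

text \<open>A configuration is a map \<open>\<int>\<^sup>2 \<Rightarrow> \<A>\<close> on the type \<open>int \<times> int\<close>; the Euclidean plane is
  \<open>real \<times> real\<close>, whose library metric is the Euclidean one.\<close>

definition lattice_pt :: "int \<times> int \<Rightarrow> real \<times> real" where
  "lattice_pt u = (real_of_int (fst u), real_of_int (snd u))"

definition shift_map :: "int \<times> int \<Rightarrow> (int \<times> int \<Rightarrow> 'a) \<Rightarrow> int \<times> int \<Rightarrow> 'a" where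
  "shift_map u x = (\<lambda>v. x (u + v))"

definition subshift :: "'a set \<Rightarrow> (int \<times> int \<Rightarrow> 'a) set \<Rightarrow> bool" where
  "subshift \<A> X \<longleftrightarrow>
     finite \<A> \<and>
     closedin (product_topology (\<lambda>_. discrete_topology \<A>) UNIV) X \<and>
     (\<forall>u. shift_map u ` X \<subseteq> X)"

definition codes ::
    "(int \<times> int \<Rightarrow> 'a) set \<Rightarrow> (real \<times> real) set \<Rightarrow> (real \<times> real) set \<Rightarrow> bool" where
  "codes X A B \<longleftrightarrow>
     (\<forall>x\<in>X. \<forall>x'\<in>X. (\<forall>u. lattice_pt u \<in> A \<longrightarrow> x u = x' u) \<longrightarrow>
                    (\<forall>u. lattice_pt u \<in> B \<longrightarrow> x u = x' u))"

text \<open>Convex polygons are filled and nondegenerate; their vertices are their extreme points.\<close>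

definition lattice_polygon :: "(real \<times> real) set \<Rightarrow> bool" where
  "lattice_polygon P \<longleftrightarrow>
     polytope P \<and> interior P \<noteq> {} \<and> (\<forall>v. v extreme_point_of P \<longrightarrow> v \<in> range lattice_pt)"

definition polygonal_wrt :: "(int \<times> int \<Rightarrow> 'a) set \<Rightarrow> (real \<times> real) set \<Rightarrow> bool" where
  "polygonal_wrt X P \<longleftrightarrow>
     infinite X \<and> lattice_polygon P \<and>
     (\<forall>v. v extreme_point_of P \<longrightarrow> codes X (P - {v}) {v})"

definition triangular :: "(int \<times> int \<Rightarrow> 'a) set \<Rightarrow> bool" where
  "triangular X \<longleftrightarrow> (\<exists>P. 2 simplex P \<and> polygonal_wrt X P)"

text \<open>For \<open>S\<close> containing infinitely many lattice points there may be infinitely many restrictions,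
  and \<open>card\<close> is then \<open>0\<close>; below, the count is only used for bounded \<open>S\<close>.\<close>

definition pattern_count :: "(int \<times> int \<Rightarrow> 'a) set \<Rightarrow> (real \<times> real) set \<Rightarrow> nat" where
  "pattern_count X S = card ((\<lambda>x. restrict x {u. lattice_pt u \<in> S}) ` X)"

definition lattice_nbhd :: "(real \<times> real) set \<Rightarrow> real \<Rightarrow> (real \<times> real) set" where
  "lattice_nbhd P r = {p \<in> range lattice_pt. infdist p P < r}"

text \<open>\<open>Lim\<close> and \<open>lim\<close> are unspecified where a limit does not exist. The outer limit only depends
  on the inner ones for large \<open>r\<close>.\<close>

definition polygon_entropy :: "(int \<times> int \<Rightarrow> 'a) set \<Rightarrow> (real \<times> real) set \<Rightarrow> real" where
  "polygon_entropy X P =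
     Lim at_top (\<lambda>r::real. lim (\<lambda>n::nat.
       ln (real (pattern_count X (lattice_nbhd ((\<lambda>p. real n *\<^sub>R p) ` P) r))) / real n))"

definition directional_entropy :: "(int \<times> int \<Rightarrow> 'a) set \<Rightarrow> real \<times> real \<Rightarrow> real" where
  "directional_entropy X v = polygon_entropy X ((\<lambda>t. t *\<^sub>R v) ` {0..1})"

definition entropy_seminorm :: "(int \<times> int \<Rightarrow> 'a) set \<Rightarrow> real \<times> real \<Rightarrow> real" where
  "entropy_seminorm X v = directional_entropy X v"

definition nontrivial_entropy_seminorm :: "(int \<times> int \<Rightarrow> 'a) set \<Rightarrow> bool" where
  "nontrivial_entropy_seminorm X \<longleftrightarrow> (\<exists>v. entropy_seminorm X v \<noteq> 0)"

end

theory Submission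
  imports Defs
begin

text \<open>The entropy seminorm of a triangular subshift measures, up to a factor, how large a homothetic
  copy of the triangle \<open>T\<close> is needed to contain a given segment; the factor is the only thing that
  depends on the subshift.

  Fix a vertex of \<open>T\<close>, move it to the origin, let \<open>a\<close> and \<open>b\<close> be the two edge vectors leaving it, and
  let \<open>F\<close>, \<open>G\<close> be the coordinates with respect to \<open>a\<close>, \<open>b\<close>. The dilated triangle is
  \<open>{F \<ge> 0, G \<ge> 0, F + G \<le> N}\<close>. A direction \<open>w = \<alpha>a + \<beta>b\<close> with \<open>\<alpha>, \<beta> \<ge> 0\<close> cuts this triangle along the
  segment from the origin to a point of the opposite side, and the points of the triangle near that
  segment code the whole triangle (\<open>strip_determines_tri\<close>): on one side of the segment the region known so
  far grows when copies of \<open>T\<close> are pushed out with the vertex \<open>b\<close> in front, on the other side with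
  the vertex \<open>a\<close> in front. These copies never leave the large triangle, because its points beyond
  the strip have \<open>G > 1\<close> on the first side and \<open>F > 1\<close> on the second. Hence a thickened segment \<open>n w\<close> carries as
  many patterns as a triangle of size \<open>n (\<alpha> + \<beta>)\<close>, up to a bounded change of the size.

  With \<open>w = a\<close> the same coding shows that a triangle is coded by two smaller triangles placed side by
  side along \<open>a\<close>. The logarithm of its number of patterns is therefore almost subadditive in the
  size and grows at a rate \<open>L\<close> by Fekete's lemma (\<open>tri_entropy_rate\<close>). So all the limits in the
  seminorm exist, and \<open>\<parallel>\<alpha>a + \<beta>b\<parallel> = (\<alpha> + \<beta>) L\<close>; the opposite vector has the same value
  (\<open>entropy_in_cone\<close>).

  The cones at the three vertices and their opposites cover the plane. Adjacent ones share an edge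
  direction, so the three rates agree, and the seminorm is \<open>L\<close> times a function of the direction that
  depends on \<open>T\<close> alone (\<open>entropy_eq_triangle_size\<close>). Nontriviality makes \<open>L\<close> positive, and the
  constant sought is the quotient of the two rates.\<close>

section \<open>Subadditive sequences\<close>

lemma subadditive_mult_add:
  fixes f :: "nat \<Rightarrow> real"
  assumes sub: "\<And>m n. f (m + n) \<le> f m + f n"
  shows "f (q * m + k) \<le> real q * f m + f k"
proof (induction q)
  case (Suc q)
  have "f (Suc q * m + k) \<le> f m + f (q * m + k)"
    using sub[of m "q * m + k"] by (simp add: add.assoc)
  with Suc show ?case by (simp add: algebra_simps)
qed simp

text \<open>Fekete's lemma: the limit is the infimum of the quotients, since division with remainder by an
  index \<open>m\<close> whose quotient is almost minimal bounds every later quotient by that of \<open>m\<close>, up to an error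
  of order \<open>1 / n\<close>.\<close>

lemma Fekete_nonneg:
  fixes f :: "nat \<Rightarrow> real"
  assumes sub: "\<And>m n. f (m + n) \<le> f m + f n" and nonneg: "\<And>n. 0 \<le> f n"
  shows "\<exists>L\<ge>0. (\<lambda>n. f n / real n) \<longlonglongrightarrow> L"
proof -
  define S where "S = (\<lambda>n. f n / real n) ` {1..}"
  define L where "L = Inf S"
  have ne: "S \<noteq> {}" by (auto simp: S_def)
  have bdd: "bdd_below S" by (rule bdd_belowI[of _ 0]) (auto simp: S_def nonneg)
  have L0: "0 \<le> L" unfolding L_def by (rule cInf_greatest[OF ne]) (auto simp: S_def nonneg)
  have "(\<lambda>n. f n / real n) \<longlonglongrightarrow> L"
  proof (rule LIMSEQ_I)
    fix e :: real assume e: "0 < e"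
    have "Inf S < L + e / 2" using e by (simp add: L_def)
    then obtain m where m: "1 \<le> m" "f m / real m < L + e / 2"
      using cInf_less_iff[OF ne bdd] by (auto simp: S_def)
    define C where "C = (\<Sum>k<m. f k)"
    have C: "f k \<le> C" if "k < m" for k
      unfolding C_def using that nonneg by (intro member_le_sum) auto
    obtain N where N: "real N > 2 * C / e" using reals_Archimedean2 by blast
    have "norm (f n / real n - L) < e" if n: "n \<ge> max 1 N" for n
    proof -
      have n0: "real n > 0" using n by simp
      have "f n = f (n div m * m + n mod m)" by simp
      also have "\<dots> \<le> real (n div m) * f m + f (n mod m)"
        by (rule subadditive_mult_add[OF sub])
      also have "\<dots> \<le> real (n div m) * f m + C" using C[of "n mod m"] m by simp
      also have "real (n div m) * f m = real (n div m * m) * (f m / real m)" using m by simp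
      also have "\<dots> \<le> real n * (f m / real m)"
        by (intro mult_right_mono) (use nonneg[of m] in \<open>auto simp del: of_nat_mult\<close>)
      finally have "f n / real n \<le> f m / real m + C / real n"
        using n0 by (simp add: field_simps)
      moreover have "C / real n < e / 2"
      proof -
        have "2 * C / e < real n" using N n by linarith
        thus ?thesis using n0 e by (simp add: field_simps)
      qed
      moreover have "L \<le> f n / real n"
        unfolding L_def by (rule cInf_lower[OF _ bdd]) (use n in \<open>auto simp: S_def\<close>)
      ultimately show ?thesis using m(2) unfolding real_norm_def by linarith
    qed
    thus "\<exists>no. \<forall>n\<ge>no. norm (f n / real n - L) < e" by blast
  qed
  with L0 show ?thesis by blast
qed

text \<open>The indices \<open>k n\<close> may stay bounded when \<open>s = 0\<close>, so this is not a composition of limits; what is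
  used is a bound \<open>\<bar>g j - L j\<bar> \<le> \<epsilon> j + C\<close> valid for every \<open>j\<close>.\<close>

lemma growth_rate_along_index:
  fixes g :: "nat \<Rightarrow> real" and k :: "nat \<Rightarrow> nat"
  assumes g: "(\<lambda>n. g n / real n) \<longlonglongrightarrow> L" and k: "(\<lambda>n. real (k n) / real n) \<longlonglongrightarrow> s"
  shows "(\<lambda>n. g (k n) / real n) \<longlonglongrightarrow> s * L"
proof -
  define d where "d n = \<bar>g (k n) / real n - L * (real (k n) / real n)\<bar>" for n
  have "d \<longlonglongrightarrow> 0"
  proof (rule LIMSEQ_I)
    fix e :: real assume e: "0 < e"
    have s0: "0 \<le> s" by (rule LIMSEQ_le_const[OF k]) auto
    define e' where "e' = e / (2 * (s + 1))"
    have e': "e' > 0" using e s0 by (simp add: e'_def)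
    obtain K where K: "\<And>n. n \<ge> K \<Longrightarrow> \<bar>g n / real n - L\<bar> < e'"
      using LIMSEQ_D[OF g e'] by auto
    define C where "C = (\<Sum>j\<le>K. \<bar>g j - L * real j\<bar>)"
    have C0: "0 \<le> C" by (auto simp: C_def intro: sum_nonneg)
    have bound: "\<bar>g j - L * real j\<bar> \<le> e' * real j + C" for j
    proof (cases "j \<le> K")
      case True
      have "\<bar>g j - L * real j\<bar> \<le> C"
        unfolding C_def using True by (intro member_le_sum[of j "{..K}" "\<lambda>j. \<bar>g j - L * real j\<bar>"]) auto
      thus ?thesis using e' by (simp add: add_increasing)
    next
      case False
      hence j: "real j > 0" by simp
      have "\<bar>g j - L * real j\<bar> = \<bar>g j / real j - L\<bar> * real j"
        using j by (simp add: field_simps abs_if zero_less_mult_iff split: if_splits)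
      also have "\<dots> \<le> e' * real j" using K[of j] False by (intro mult_right_mono) auto
      finally show ?thesis using C0 by simp
    qed
    have "eventually (\<lambda>n. real (k n) / real n < s + 1) sequentially"
      using k by (rule order_tendstoD) simp
    moreover have "(\<lambda>n. C / real n) \<longlonglongrightarrow> 0" by (rule lim_const_over_n)
    hence "eventually (\<lambda>n. C / real n < e / 2) sequentially"
      by (rule order_tendstoD) (use e in simp)
    moreover have "eventually (\<lambda>n::nat. n > 0) sequentially" by (rule eventually_gt_at_top)
    ultimately have "eventually (\<lambda>n. norm (d n - 0) < e) sequentially"
    proof eventually_elim
      case (elim n)
      have "d n = \<bar>g (k n) - L * real (k n)\<bar> / real n"
        by (simp add: d_def flip: diff_divide_distrib)
      also have "\<dots> \<le> (e' * real (k n) + C) / real n"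
        using bound by (intro divide_right_mono) auto
      also have "\<dots> = e' * (real (k n) / real n) + C / real n" by (simp add: add_divide_distrib)
      also have "\<dots> < e' * (s + 1) + e / 2"
        using elim e' by (intro add_strict_mono mult_strict_left_mono) auto
      also have "e' * (s + 1) = e / 2" using s0 by (simp add: e'_def field_simps)
      finally show ?case by (simp add: d_def)
    qed
    thus "\<exists>no. \<forall>n\<ge>no. norm (d n - 0) < e" by (simp add: eventually_sequentially)
  qed
  hence "(\<lambda>n. g (k n) / real n - L * (real (k n) / real n)) \<longlonglongrightarrow> 0"
    unfolding d_def by (simp add: tendsto_rabs_zero_iff)
  from tendsto_add[OF this tendsto_mult[OF tendsto_const[of L] k]]
  show ?thesis by (simp add: mult.commute)
qed

section \<open>Counting the patterns of a subshift\<close>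

text \<open>The versions of \<open>codes\<close> and \<open>pattern_count\<close> for sets of lattice points: translations and unions are
  then taken inside \<open>\<int>\<^sup>2\<close>, where the shift acts.\<close>

definition determines ::
    "(int \<times> int \<Rightarrow> 'a) set \<Rightarrow> (int \<times> int) set \<Rightarrow> (int \<times> int) set \<Rightarrow> bool" where
  "determines X A B \<longleftrightarrow>
     (\<forall>x\<in>X. \<forall>x'\<in>X. (\<forall>u\<in>A. x u = x' u) \<longrightarrow> (\<forall>u\<in>B. x u = x' u))"

definition block_count :: "(int \<times> int \<Rightarrow> 'a) set \<Rightarrow> (int \<times> int) set \<Rightarrow> nat" where
  "block_count X A = card ((\<lambda>x. restrict x A) ` X)"

lemma pattern_count_eq_block_count: "pattern_count X S = block_count X {u. lattice_pt u \<in> S}"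
  by (simp add: pattern_count_def block_count_def)

lemma determinesD:
  "determines X A B \<Longrightarrow> x \<in> X \<Longrightarrow> x' \<in> X \<Longrightarrow> (\<And>u. u \<in> A \<Longrightarrow> x u = x' u) \<Longrightarrow> v \<in> B \<Longrightarrow> x v = x' v"
  unfolding determines_def by blast

lemma determines_subset: "B \<subseteq> A \<Longrightarrow> determines X A B"
  by (auto simp: determines_def)

lemma determines_Un:
  "determines X A B \<Longrightarrow> determines X A C \<Longrightarrow> D \<subseteq> B \<union> C \<Longrightarrow> determines X A D"
  unfolding determines_def by blast

lemma determines_trans: "determines X A B \<Longrightarrow> determines X B C \<Longrightarrow> determines X A C"
  unfolding determines_def by meson

lemma restrict_eq_iff: "restrict x A = restrict x' A \<longleftrightarrow> (\<forall>u\<in>A. x u = x' u)"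
  by (auto simp: restrict_def fun_eq_iff)

lemma card_image_le_if_factors:
  assumes "finite (p ` X)" and "\<And>x x'. x \<in> X \<Longrightarrow> x' \<in> X \<Longrightarrow> p x = p x' \<Longrightarrow> q x = q x'"
  shows "card (q ` X) \<le> card (p ` X)"
proof -
  have "q x \<in> (\<lambda>y. q (inv_into X p y)) ` p ` X" if "x \<in> X" for x
  proof -
    have "q x = q (inv_into X p (p x))"
      by (rule assms(2)) (use that in \<open>auto intro: inv_into_into simp: f_inv_into_f\<close>)
    thus ?thesis using that by blast
  qed
  hence "q ` X \<subseteq> (\<lambda>y. q (inv_into X p y)) ` p ` X" by blast
  hence "card (q ` X) \<le> card ((\<lambda>y. q (inv_into X p y)) ` p ` X)"
    using assms(1) by (intro card_mono) auto
  also have "\<dots> \<le> card (p ` X)" using assms(1) by (rule card_image_le)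
  finally show ?thesis .
qed

locale nonempty_subshift =
  fixes \<A> :: "'a set" and X :: "(int \<times> int \<Rightarrow> 'a) set"
  assumes subshift: "subshift \<A> X" and nonempty: "X \<noteq> {}"
begin

lemma shift_in: "x \<in> X \<Longrightarrow> (\<lambda>v. x (u + v)) \<in> X"
  using subshift unfolding subshift_def shift_map_def by blast

lemma value_in: "x \<in> X \<Longrightarrow> x u \<in> \<A>"
  using subshift closedin_subset[of "product_topology (\<lambda>_. discrete_topology \<A>) UNIV" X]
  unfolding subshift_def by (auto simp: PiE_iff)

lemma finite_blocks: "finite A \<Longrightarrow> finite ((\<lambda>x. restrict x A) ` X)"
proof -
  assume A: "finite A"
  have "(\<lambda>x. restrict x A) ` X \<subseteq> (\<Pi>\<^sub>E u\<in>A. \<A>)" using value_in by auto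
  moreover have "finite (\<Pi>\<^sub>E u\<in>A. \<A>)"
    using A subshift by (intro finite_PiE) (auto simp: subshift_def)
  ultimately show ?thesis by (rule finite_subset)
qed

lemma block_count_ge_1: "finite A \<Longrightarrow> 1 \<le> block_count X A"
  using finite_blocks nonempty by (auto simp: block_count_def Suc_le_eq card_gt_0_iff)

text \<open>Both inclusion and coding bound pattern counts through this inequality.\<close>

lemma block_count_mono: "finite A \<Longrightarrow> determines X A B \<Longrightarrow> block_count X B \<le> block_count X A"
  unfolding block_count_def determines_def
  by (rule card_image_le_if_factors[OF finite_blocks]) (simp_all add: restrict_eq_iff)

lemma block_count_translate_le: "finite A \<Longrightarrow> block_count X ((+) u ` A) \<le> block_count X A"
proof -
  assume A: "finite A"
  have "block_count X ((+) u ` A) \<le> card ((\<lambda>x. restrict (\<lambda>v. x (u + v)) A) ` X)"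
    unfolding block_count_def
    by (rule card_image_le_if_factors)
       (auto simp: restrict_eq_iff intro: finite_subset[OF _ finite_blocks[OF A]] shift_in)
  also have "\<dots> \<le> block_count X A"
    unfolding block_count_def using shift_in[of _ u] by (intro card_mono finite_blocks A) blast
  finally show ?thesis .
qed

lemma block_count_translate: "finite A \<Longrightarrow> block_count X ((+) u ` A) = block_count X A"
proof -
  assume A: "finite A"
  have "(+) (- u) ` (+) u ` A = A" by (simp add: image_image)
  hence "block_count X A \<le> block_count X ((+) u ` A)"
    using block_count_translate_le[of "(+) u ` A" "- u"] A by simp
  with block_count_translate_le[OF A, of u] show ?thesis by simp
qed

lemma block_count_Un:
  assumes "finite A" "finite B"
  shows "block_count X (A \<union> B) \<le> block_count X A * block_count X B"
proof -
  let ?p = "\<lambda>x. (restrict x A, restrict x B)"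
  have sub: "?p ` X \<subseteq> (\<lambda>x. restrict x A) ` X \<times> (\<lambda>x. restrict x B) ` X" by auto
  have fin: "finite ((\<lambda>x. restrict x A) ` X \<times> (\<lambda>x. restrict x B) ` X)"
    using assms by (simp add: finite_blocks)
  have "block_count X (A \<union> B) \<le> card (?p ` X)"
    unfolding block_count_def
    by (rule card_image_le_if_factors[OF finite_subset[OF sub fin]]) (auto simp: restrict_eq_iff)
  also have "\<dots> \<le> block_count X A * block_count X B"
    using card_mono[OF fin sub] by (simp add: block_count_def card_cartesian_product)
  finally show ?thesis .
qed

end

section \<open>Lattice points and coordinates\<close>

lemma lattice_pt_add: "lattice_pt (u + v) = lattice_pt u + lattice_pt v"
  and lattice_pt_diff: "lattice_pt (u - v) = lattice_pt u - lattice_pt v"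
  by (simp_all add: lattice_pt_def zero_prod_def)

lemma lattice_pt_eq_iff: "lattice_pt u = lattice_pt v \<longleftrightarrow> u = v"
  by (simp add: lattice_pt_def prod_eq_iff)

lemma finite_bounded_lattice:
  assumes "bounded S"
  shows "finite {u. lattice_pt u \<in> S}"
proof -
  obtain K where K: "\<And>p. p \<in> S \<Longrightarrow> norm p \<le> K" using assms by (auto simp: bounded_iff)
  have "{u. lattice_pt u \<in> S} \<subseteq> {- \<lceil>K\<rceil>..\<lceil>K\<rceil>} \<times> {- \<lceil>K\<rceil>..\<lceil>K\<rceil>}"
  proof
    fix u assume "u \<in> {u. lattice_pt u \<in> S}"
    hence "norm (lattice_pt u) \<le> K" using K by simp
    hence "\<bar>real_of_int (fst u)\<bar> \<le> K" "\<bar>real_of_int (snd u)\<bar> \<le> K"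
      using norm_fst_le[of "real_of_int (fst u)" "real_of_int (snd u)"]
        norm_snd_le[of "real_of_int (snd u)" "real_of_int (fst u)"]
      unfolding lattice_pt_def real_norm_def by linarith+
    thus "u \<in> {- \<lceil>K\<rceil>..\<lceil>K\<rceil>} \<times> {- \<lceil>K\<rceil>..\<lceil>K\<rceil>}"
      by (auto simp: mem_Times_iff) linarith+
  qed
  thus ?thesis by (rule finite_subset) simp
qed

lemma collinear_diffs: "collinear {p, q, s} \<longleftrightarrow> collinear {0, q - p, s - p}"
  for p q s :: "'a::euclidean_space"
  using collinear_3[of q p s] by (simp add: insert_commute)

lemma linear_coordinates:
  fixes a b :: "real \<times> real"
  assumes "\<not> collinear {0, a, b}"
  obtains f g :: "real \<times> real \<Rightarrow> real" where
    "linear f" "linear g" "\<And>z. z = f z *\<^sub>R a + g z *\<^sub>R b" "f a = 1" "g a = 0" "f b = 0" "g b = 1"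
proof -
  define D where "D = fst a * snd b - snd a * fst b"
  have D: "D \<noteq> 0"
  proof
    assume "D = 0"
    hence *: "fst a * snd b = snd a * fst b" by (simp add: D_def)
    have "collinear {0, a, b}"
    proof (cases "fst a = 0")
      case True
      show ?thesis
      proof (cases "snd a = 0")
        case True
        with \<open>fst a = 0\<close> have "a = 0" by (simp add: prod_eq_iff)
        thus ?thesis by (simp add: collinear_lemma)
      next
        case False
        with True * have "b = (snd b / snd a) *\<^sub>R a" by (simp add: prod_eq_iff)
        thus ?thesis unfolding collinear_lemma by blast
      qed
    next
      case False
      with * have "b = (fst b / fst a) *\<^sub>R a" by (simp add: prod_eq_iff field_simps)
      thus ?thesis unfolding collinear_lemma by blast
    qed
    with assms show False by simp
  qed
  let ?f = "\<lambda>z::real\<times>real. (fst z * snd b - snd z * fst b) / D"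
  let ?g = "\<lambda>z::real\<times>real. (fst a * snd z - snd a * fst z) / D"
  show ?thesis
  proof (rule that[of ?f ?g])
    show "linear ?f" "linear ?g" by (rule linearI; simp add: algebra_simps add_divide_distrib diff_divide_distrib)+
    show "z = ?f z *\<^sub>R a + ?g z *\<^sub>R b" for z
    proof -
      have "fst z * D = (fst z * snd b - snd z * fst b) * fst a + (fst a * snd z - snd a * fst z) * fst b"
        by (simp add: D_def algebra_simps)
      hence "fst z = ((fst z * snd b - snd z * fst b) * fst a + (fst a * snd z - snd a * fst z) * fst b) / D"
        by (rule iffD2[OF nonzero_eq_divide_eq[OF D]])
      moreover have "snd z * D = (fst z * snd b - snd z * fst b) * snd a + (fst a * snd z - snd a * fst z) * snd b"
        by (simp add: D_def algebra_simps)
      hence "snd z = ((fst z * snd b - snd z * fst b) * snd a + (fst a * snd z - snd a * fst z) * snd b) / D"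
        by (rule iffD2[OF nonzero_eq_divide_eq[OF D]])
      ultimately show ?thesis by (simp only: prod_eq_iff fst_add snd_add fst_scaleR snd_scaleR real_scaleR_def
            add_divide_distrib times_divide_eq_left)
    qed
  qed (use D in \<open>simp_all add: D_def mult.commute\<close>)
qed

section \<open>Coding a triangle from a strip\<close>

text \<open>The triangle has vertices \<open>0\<close>, \<open>a\<close> and \<open>b\<close>, and \<open>0\<close> is the apex of the cone of directions
  under study: a strip along such a direction is widened on its two sides by the corners \<open>a\<close> and \<open>b\<close>,
  respectively.\<close>

locale corner_coded_subshift = nonempty_subshift \<A> X
  for \<A> :: "'a set" and X :: "(int \<times> int \<Rightarrow> 'a) set" +
  fixes a b :: "int \<times> int" and f g :: "real \<times> real \<Rightarrow> real"
  assumes linear_f: "linear f" and linear_g: "linear g"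
    and coords: "\<And>z. z = f z *\<^sub>R lattice_pt a + g z *\<^sub>R lattice_pt b"
    and f_a: "f (lattice_pt a) = 1" and g_a: "g (lattice_pt a) = 0"
    and f_b: "f (lattice_pt b) = 0" and g_b: "g (lattice_pt b) = 1"
    and corner_a: "determines X
      {w. 0 \<le> f (lattice_pt w) \<and> 0 \<le> g (lattice_pt w) \<and>
          f (lattice_pt w) + g (lattice_pt w) \<le> 1 \<and> w \<noteq> a} {a}"
    and corner_b: "determines X
      {w. 0 \<le> f (lattice_pt w) \<and> 0 \<le> g (lattice_pt w) \<and>
          f (lattice_pt w) + g (lattice_pt w) \<le> 1 \<and> w \<noteq> b} {b}"
begin

abbreviation F :: "int \<times> int \<Rightarrow> real" where "F u \<equiv> f (lattice_pt u)"
abbreviation G :: "int \<times> int \<Rightarrow> real" where "G u \<equiv> g (lattice_pt u)"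

definition tri :: "nat \<Rightarrow> (int \<times> int) set" where
  "tri N = {u. 0 \<le> F u \<and> 0 \<le> G u \<and> F u + G u \<le> real N}"

text \<open>The functional \<open>\<alpha> G - \<beta> F\<close> vanishes on the direction \<open>\<alpha>a + \<beta>b\<close> and takes the values \<open>0\<close>, \<open>- \<beta>\<close>
  and \<open>\<alpha>\<close> at the vertices \<open>0\<close>, \<open>a\<close> and \<open>b\<close>: the strip is exactly as wide as the unit triangle seen
  in that direction.\<close>

definition strip :: "real \<Rightarrow> real \<Rightarrow> (int \<times> int) set" where
  "strip \<alpha> \<beta> = {u. - \<beta> \<le> \<alpha> * G u - \<beta> * F u \<and> \<alpha> * G u - \<beta> * F u \<le> \<alpha>}"

lemma swap: "corner_coded_subshift \<A> X b a g f"
proof (rule corner_coded_subshift.intro[OF nonempty_subshift_axioms],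
    rule corner_coded_subshift_axioms.intro)
  show "z = g z *\<^sub>R lattice_pt b + f z *\<^sub>R lattice_pt a" for z
    using coords[of z] by (simp add: add.commute)
qed (use linear_f linear_g f_a g_a f_b g_b corner_a corner_b in
      \<open>simp_all add: add.commute conj_ac cong: conj_cong\<close>)

lemmas FG_simps = lattice_pt_add lattice_pt_diff linear_add[OF linear_f] linear_add[OF linear_g]
  linear_diff[OF linear_f] linear_diff[OF linear_g] f_a g_a f_b g_b

lemma FG_inject: "F u = F v \<Longrightarrow> G u = G v \<Longrightarrow> u = v"
  using coords[of "lattice_pt u"] coords[of "lattice_pt v"] by (simp flip: lattice_pt_eq_iff)

lemma finite_tri: "finite (tri N)"
proof -
  have "norm (lattice_pt u) \<le> real N * norm (lattice_pt a) + real N * norm (lattice_pt b)"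
    if "u \<in> tri N" for u
  proof -
    have "norm (lattice_pt u) \<le> norm (F u *\<^sub>R lattice_pt a) + norm (G u *\<^sub>R lattice_pt b)"
      by (subst coords) (rule norm_triangle_ineq)
    also have "\<dots> \<le> real N * norm (lattice_pt a) + real N * norm (lattice_pt b)"
      using that by (auto simp: tri_def intro!: add_mono mult_right_mono)
    finally show ?thesis .
  qed
  hence "bounded (lattice_pt ` tri N)" unfolding bounded_iff by blast
  from finite_bounded_lattice[OF this] show ?thesis by (rule finite_subset[rotated]) auto
qed

lemma corner_b_translate:
  assumes "x \<in> X" "x' \<in> X" and eq: "\<And>t. t \<in> tri 1 \<Longrightarrow> t \<noteq> b \<Longrightarrow> x (u - b + t) = x' (u - b + t)"
  shows "x u = x' u"
proof -
  have "x (u - b + b) = x' (u - b + b)"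
    by (rule determinesD[OF corner_b shift_in[OF assms(1)] shift_in[OF assms(2)]])
       (use eq in \<open>auto simp: tri_def\<close>)
  thus ?thesis by simp
qed

text \<open>Above the strip, a point \<open>u\<close> is the vertex \<open>b\<close> of the translate \<open>u - b + T\<close>. The other points of this
  translate have a strictly smaller value of \<open>\<phi>\<close>, and they stay in the large triangle because
  \<open>\<phi> u > \<alpha>\<close> forces \<open>G u > 1\<close>. So two configurations that agree on the strip cannot disagree at a
  point with the least \<open>\<phi>\<close> among all disagreements.\<close>

lemma determines_upper_half:
  assumes "0 \<le> \<alpha>" "0 \<le> \<beta>"
  shows "determines X (tri N \<inter> strip \<alpha> \<beta>) {u\<in>tri N. - \<beta> \<le> \<alpha> * G u - \<beta> * F u}"
  unfolding determines_def
proof (intro ballI impI, rule ccontr)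
  define \<phi> where "\<phi> u = \<alpha> * G u - \<beta> * F u" for u
  fix x x' u0
  assume x: "x \<in> X" "x' \<in> X" and eq: "\<forall>u\<in>tri N \<inter> strip \<alpha> \<beta>. x u = x' u"
    and "u0 \<in> {u\<in>tri N. - \<beta> \<le> \<alpha> * G u - \<beta> * F u}" "x u0 \<noteq> x' u0"
  define E where "E = {u\<in>tri N. - \<beta> \<le> \<phi> u \<and> x u \<noteq> x' u}"
  have "u0 \<in> E" using \<open>u0 \<in> _\<close> \<open>x u0 \<noteq> x' u0\<close> by (simp add: E_def \<phi>_def)
  moreover have "finite E" using finite_tri by (simp add: E_def)
  ultimately obtain u where u: "u \<in> E" and min: "\<And>w. w \<in> E \<Longrightarrow> \<not> \<phi> w < \<phi> u"
    using ex_is_arg_min_if_finite[of E \<phi>] by (auto simp: is_arg_min_def)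
  have FGu: "0 \<le> F u" "0 \<le> G u" "F u + G u \<le> real N" using u by (auto simp: E_def tri_def)
  have "\<phi> u > \<alpha>" using u eq by (force simp: E_def strip_def \<phi>_def)
  hence big: "\<alpha> * G u > \<alpha> + \<beta> * F u" by (simp add: \<phi>_def)
  \<comment> \<open>If \<open>w\<close> is parallel to the edge \<open>b\<close>, no point of the triangle lies above the strip.\<close>
  have \<alpha>: "\<alpha> > 0"
  proof (rule ccontr)
    assume "\<not> \<alpha> > 0"
    with assms have "\<alpha> = 0" by simp
    moreover have "0 \<le> \<beta> * F u" using assms FGu by simp
    ultimately show False using big by simp
  qed
  have "\<alpha> * G u > \<alpha> * 1" using big assms FGu mult_nonneg_nonneg[of \<beta> "F u"] by linarith
  hence G1: "G u > 1" using \<alpha> by (simp only: mult_less_cancel_left_pos)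
  have "x u = x' u"
  proof (rule corner_b_translate[OF x])
    fix t assume t: "t \<in> tri 1" "t \<noteq> b"
    let ?w = "u - b + t"
    have FGt: "0 \<le> F t" "0 \<le> G t" "F t + G t \<le> 1" using t by (auto simp: tri_def)
    have "G t \<noteq> 1"
    proof
      assume "G t = 1"
      with FGt have "F t = 0" by simp
      with \<open>G t = 1\<close> t show False using FG_inject[of t b] by (simp add: FG_simps)
    qed
    with FGt have Gt: "G t < 1" by simp
    have w: "?w \<in> tri N" using FGt FGu G1 by (simp add: tri_def FG_simps)
    have \<phi>w: "\<phi> ?w = \<phi> u - \<alpha> + \<alpha> * G t - \<beta> * F t" by (simp add: \<phi>_def FG_simps algebra_simps)
    have "\<alpha> * G t < \<alpha> * 1" using \<alpha> Gt by (intro mult_strict_left_mono) auto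
    moreover have "0 \<le> \<beta> * F t" "0 \<le> \<alpha> * G t" using assms FGt by simp_all
    moreover have "\<beta> * F t \<le> \<beta> * 1" using assms FGt by (intro mult_left_mono) auto
    ultimately have "\<phi> ?w < \<phi> u" "- \<beta> \<le> \<phi> ?w" using \<phi>w \<open>\<phi> u > \<alpha>\<close> by linarith+
    with min[of ?w] w show "x ?w = x' ?w" by (auto simp: E_def)
  qed
  with u show False by (simp add: E_def)
qed

text \<open>Exchanging \<open>a\<close> with \<open>b\<close> and \<open>\<alpha>\<close> with \<open>\<beta>\<close> reverses the sign of the functional, so the part below the
  strip is the upper part of the exchanged situation.\<close>

lemma strip_determines_tri:
  assumes "0 \<le> \<alpha>" "0 \<le> \<beta>"
  shows "determines X (tri N \<inter> strip \<alpha> \<beta>) (tri N)"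
proof -
  interpret swapped: corner_coded_subshift \<A> X b a g f by (rule swap)
  have tri: "swapped.tri N = tri N" by (auto simp: tri_def swapped.tri_def)
  have strip: "swapped.strip \<beta> \<alpha> = strip \<alpha> \<beta>" by (auto simp: strip_def swapped.strip_def)
  have lower: "determines X (tri N \<inter> strip \<alpha> \<beta>) {u\<in>tri N. - \<alpha> \<le> \<beta> * F u - \<alpha> * G u}"
    using swapped.determines_upper_half[OF assms(2,1), of N] by (simp only: tri strip)
  have "tri N \<subseteq> {u\<in>tri N. - \<alpha> \<le> \<beta> * F u - \<alpha> * G u} \<union> {u\<in>tri N. - \<beta> \<le> \<alpha> * G u - \<beta> * F u}"
    using assms by auto
  with lower determines_upper_half[OF assms] show ?thesis by (rule determines_Un)
qed

definition comb :: "int \<Rightarrow> int \<Rightarrow> int \<times> int" where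
  "comb i j = (i * fst a + j * fst b, i * snd a + j * snd b)"

lemma lattice_pt_comb: "lattice_pt (comb i j) = of_int i *\<^sub>R lattice_pt a + of_int j *\<^sub>R lattice_pt b"
  by (simp add: comb_def lattice_pt_def)

lemma F_comb: "F (comb i j) = of_int i" and G_comb: "G (comb i j) = of_int j"
  by (simp_all add: lattice_pt_comb FG_simps linear_scale[OF linear_f] linear_scale[OF linear_g])

definition tri_entropy :: "nat \<Rightarrow> real" where
  "tri_entropy N = ln (real (block_count X (tri N)))"

lemma tri_entropy_nonneg: "0 \<le> tri_entropy N"
  using block_count_ge_1[OF finite_tri, of N] by (simp add: tri_entropy_def)

text \<open>The bottom strip \<open>0 \<le> G \<le> 1\<close> codes the triangle, and two triangles placed side by side cover it once
  the left one is enlarged by one: near its right corner a triangle is lower than the strip. The right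
  one is enlarged too, for symmetry.\<close>

lemma tri_entropy_almost_subadditive:
  "tri_entropy (m + n) \<le> tri_entropy (m + 1) + tri_entropy (n + 1)"
proof -
  let ?T = "(+) (comb (int m) 0) ` tri (n + 1)"
  have "tri (m + n) \<inter> strip 1 0 \<subseteq> tri (m + 1) \<union> ?T"
  proof
    fix u assume "u \<in> tri (m + n) \<inter> strip 1 0"
    hence u: "0 \<le> F u" "0 \<le> G u" "F u + G u \<le> real m + real n" "G u \<le> 1"
      by (auto simp: tri_def strip_def)
    show "u \<in> tri (m + 1) \<union> ?T"
    proof (cases "F u \<le> real m")
      case True
      with u show ?thesis by (simp add: tri_def)
    next
      case False
      with u have "u - comb (int m) 0 \<in> tri (n + 1)" by (simp add: tri_def FG_simps F_comb G_comb)
      moreover have "u = comb (int m) 0 + (u - comb (int m) 0)" by simp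
      ultimately show ?thesis by blast
    qed
  qed
  hence "determines X (tri (m + 1) \<union> ?T) (tri (m + n))"
    by (intro determines_trans[OF determines_subset strip_determines_tri[of 1 0]]) auto
  hence "block_count X (tri (m + n)) \<le> block_count X (tri (m + 1) \<union> ?T)"
    by (intro block_count_mono) (simp_all add: finite_tri)
  also have "\<dots> \<le> block_count X (tri (m + 1)) * block_count X ?T"
    by (intro block_count_Un) (simp_all add: finite_tri)
  also have "block_count X ?T = block_count X (tri (n + 1))"
    by (rule block_count_translate[OF finite_tri])
  finally have le: "block_count X (tri (m + n)) \<le> block_count X (tri (m + 1)) * block_count X (tri (n + 1))" .
  have pos: "0 < block_count X (tri k)" for k using block_count_ge_1[OF finite_tri, of k] by simp
  have "tri_entropy (m + n) \<le> ln (real (block_count X (tri (m + 1)) * block_count X (tri (n + 1))))"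
    unfolding tri_entropy_def using le pos by (intro iffD2[OF ln_le_cancel_iff]) (auto simp del: of_nat_mult)
  also have "\<dots> = tri_entropy (m + 1) + tri_entropy (n + 1)"
    using pos by (simp add: tri_entropy_def ln_mult)
  finally show ?thesis .
qed

text \<open>Replacing the size \<open>n\<close> by \<open>n + 2\<close> absorbs the two unit enlargements into exact subadditivity.\<close>

lemma tri_entropy_rate: "\<exists>L\<ge>0. (\<lambda>N. tri_entropy N / real N) \<longlonglongrightarrow> L"
proof -
  have "\<exists>L\<ge>0. (\<lambda>n. tri_entropy (n + 2) / real n) \<longlonglongrightarrow> L"
  proof (rule Fekete_nonneg)
    fix m n
    show "tri_entropy (m + n + 2) \<le> tri_entropy (m + 2) + tri_entropy (n + 2)"
      using tri_entropy_almost_subadditive[of "m + 1" "n + 1"] by simp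
  qed (rule tri_entropy_nonneg)
  then obtain L where L: "L \<ge> 0" "(\<lambda>n. tri_entropy (n + 2) / real n) \<longlonglongrightarrow> L" by blast
  have "(\<lambda>n. real n / real (n + 2)) \<longlonglongrightarrow> 1"
  proof -
    have "(\<lambda>n. real n / real (n + 2)) = (\<lambda>n. 1 - 2 / real (n + 2))" by (auto simp: field_simps)
    moreover have "(\<lambda>n. 1 - 2 / real (n + 2)) \<longlonglongrightarrow> 1 - 0"
      using LIMSEQ_ignore_initial_segment[OF lim_const_over_n[of "2::real"], of 2]
      by (intro tendsto_diff) auto
    ultimately show ?thesis by simp
  qed
  from tendsto_mult[OF L(2) this]
  have "(\<lambda>n. tri_entropy (n + 2) / real n * (real n / real (n + 2))) \<longlonglongrightarrow> L" by simp
  moreover have "eventually (\<lambda>n. tri_entropy (n + 2) / real n * (real n / real (n + 2)) =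
      tri_entropy (n + 2) / real (n + 2)) sequentially"
    using eventually_gt_at_top[of 0] by eventually_elim simp
  ultimately have "(\<lambda>n. tri_entropy (n + 2) / real (n + 2)) \<longlonglongrightarrow> L"
    using tendsto_cong by fast
  hence "(\<lambda>N. tri_entropy N / real N) \<longlonglongrightarrow> L" by (rule LIMSEQ_offset)
  with L(1) show ?thesis by blast
qed

end

section \<open>Entropy in a cone of directions\<close>

definition cone_rate :: "(int \<times> int \<Rightarrow> 'a) set \<Rightarrow> real \<times> real \<Rightarrow> real \<times> real \<Rightarrow> real \<Rightarrow> bool" where
  "cone_rate X a b L \<longleftrightarrow> (\<forall>\<alpha>\<ge>0. \<forall>\<beta>\<ge>0. \<forall>v\<in>{\<alpha> *\<^sub>R a + \<beta> *\<^sub>R b, - (\<alpha> *\<^sub>R a + \<beta> *\<^sub>R b)}.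
     entropy_seminorm X v = (\<alpha> + \<beta>) * L)"

text \<open>The starting point \<open>q\<close> is an arbitrary point of the plane: a segment from the origin in the direction
  \<open>- w\<close> is one in the direction \<open>w\<close> from a starting point that need not be in the lattice.\<close>

definition seg_nbhd :: "real \<times> real \<Rightarrow> real \<Rightarrow> real \<times> real \<Rightarrow> real \<Rightarrow> (int \<times> int) set" where
  "seg_nbhd q l w r = {u. \<exists>t. 0 \<le> t \<and> t \<le> l \<and> dist (lattice_pt u) (q + t *\<^sub>R w) < r}"

lemma lattice_nbhd_segment:
  assumes "v = w \<and> q = 0 \<or> v = - w \<and> q = - (real n *\<^sub>R w)"
  shows "{u. lattice_pt u \<in> lattice_nbhd ((\<lambda>p. real n *\<^sub>R p) ` (\<lambda>t. t *\<^sub>R v) ` {0..1}) r}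
           = seg_nbhd q (real n) w r"
proof -
  let ?A = "(\<lambda>p. real n *\<^sub>R p) ` (\<lambda>t. t *\<^sub>R v) ` {0..1}"
  have ne: "?A \<noteq> {}" by simp
  have A: "?A = (\<lambda>t. q + t *\<^sub>R w) ` {0..real n}"
  proof (intro equalityI subsetI)
    fix z assume "z \<in> ?A"
    then obtain t where t: "0 \<le> t" "t \<le> 1" "z = real n *\<^sub>R t *\<^sub>R v" by auto
    have "0 \<le> real n * t" "real n * t \<le> real n" using t by (simp_all add: mult_left_le)
    moreover from this have "0 \<le> real n * (1 - t)" "real n * (1 - t) \<le> real n"
      by (simp_all add: right_diff_distrib)
    moreover have "z = q + (real n * t) *\<^sub>R w \<or> z = q + (real n * (1 - t)) *\<^sub>R w"
      using assms t(3) by (auto simp: algebra_simps)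
    ultimately show "z \<in> (\<lambda>t. q + t *\<^sub>R w) ` {0..real n}" by auto
  next
    fix z assume "z \<in> (\<lambda>t. q + t *\<^sub>R w) ` {0..real n}"
    then obtain t where t: "0 \<le> t" "t \<le> real n" "z = q + t *\<^sub>R w" by auto
    show "z \<in> ?A"
    proof (cases "n = 0")
      case True
      with t assms have "z = 0" by auto
      with True show ?thesis by (auto simp: image_image image_iff intro: bexI[of _ 0])
    next
      case False
      have "z = real n *\<^sub>R (t / real n) *\<^sub>R v \<or> z = real n *\<^sub>R (1 - t / real n) *\<^sub>R v"
        using assms t(3) False by (auto simp: algebra_simps)
      moreover have "t / real n \<in> {0..1}" "1 - t / real n \<in> {0..1}"
        using t False by (auto simp: field_simps)
      ultimately show ?thesis by blast
    qed
  qed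
  have "infdist z ?A < r \<longleftrightarrow> (\<exists>y\<in>?A. dist z y < r)" for z
    unfolding infdist_notempty[OF ne] by (subst cInf_less_iff) (use ne in \<open>auto intro: bdd_belowI2\<close>)
  thus ?thesis unfolding A seg_nbhd_def lattice_nbhd_def by auto
qed

context corner_coded_subshift
begin

text \<open>Moving the triangle's sides outwards by a bounded amount and rounding its corner to an integer
  combination of \<open>a\<close> and \<open>b\<close> costs a bounded increase of the size, whatever the segment.\<close>

lemma seg_nbhd_in_tri:
  assumes "0 \<le> \<alpha>" "0 \<le> \<beta>"
  defines "w \<equiv> \<alpha> *\<^sub>R lattice_pt a + \<beta> *\<^sub>R lattice_pt b"
  shows "\<exists>C. \<forall>q l. \<exists>k. seg_nbhd q l w r \<subseteq> (+) k ` tri (nat \<lceil>l * (\<alpha> + \<beta>)\<rceil> + C)"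
proof -
  obtain K1 where K1: "K1 > 0" "\<And>z. norm (f z) \<le> K1 * norm z" using linear_bounded_pos[OF linear_f] by blast
  obtain K2 where K2: "K2 > 0" "\<And>z. norm (g z) \<le> K2 * norm z" using linear_bounded_pos[OF linear_g] by blast
  define c where "c = nat \<lceil>max (K1 * r) (K2 * r)\<rceil>"
  have c: "K1 * r \<le> real c" "K2 * r \<le> real c" unfolding c_def by linarith+
  have fw: "f w = \<alpha>" "g w = \<beta>"
    by (simp_all add: w_def FG_simps linear_scale[OF linear_f] linear_scale[OF linear_g])
  have "seg_nbhd q l w r \<subseteq> (+) (comb (\<lfloor>f q\<rfloor> - int c) (\<lfloor>g q\<rfloor> - int c)) `
           tri (nat \<lceil>l * (\<alpha> + \<beta>)\<rceil> + (4 * c + 2))" (is "_ \<subseteq> (+) ?k ` tri ?N") for q l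
  proof
    fix u assume "u \<in> seg_nbhd q l w r"
    then obtain t where t: "0 \<le> t" "t \<le> l" "dist (lattice_pt u) (q + t *\<^sub>R w) < r"
      by (auto simp: seg_nbhd_def)
    define z where "z = lattice_pt u - (q + t *\<^sub>R w)"
    have nz: "norm z < r" using t by (simp add: z_def dist_norm)
    have u: "lattice_pt u = z + (q + t *\<^sub>R w)" by (simp add: z_def)
    have Fu: "F u = f z + (f q + t * \<alpha>)" and Gu: "G u = g z + (g q + t * \<beta>)"
      by (simp_all add: u FG_simps linear_scale[OF linear_f] linear_scale[OF linear_g] fw)
    have "K1 * norm z \<le> K1 * r" "K2 * norm z \<le> K2 * r"
      using nz K1 K2 by (intro mult_left_mono; simp)+
    hence err: "\<bar>f z\<bar> \<le> real c" "\<bar>g z\<bar> \<le> real c"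
      using K1(2)[of z] K2(2)[of z] c unfolding real_norm_def by linarith+
    have pos: "0 \<le> t * \<alpha>" "0 \<le> t * \<beta>" using t assms by simp_all
    have "t * (\<alpha> + \<beta>) \<le> l * (\<alpha> + \<beta>)" using t assms by (intro mult_right_mono) auto
    hence tl: "t * \<alpha> + t * \<beta> \<le> real (nat \<lceil>l * (\<alpha> + \<beta>)\<rceil>)" unfolding distrib_left by linarith
    have "u - ?k \<in> tri ?N"
      using err pos tl unfolding tri_def
      by (simp add: FG_simps F_comb G_comb Fu Gu) linarith
    moreover have "u = ?k + (u - ?k)" by simp
    ultimately show "u \<in> (+) ?k ` tri ?N" by blast
  qed
  thus ?thesis by blast
qed

text \<open>A point \<open>u\<close> of the strip is compared with the point \<open>t w\<close> of the segment that has the same value of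
  \<open>F + G\<close>; the difference is \<open>(\<alpha> G u - \<beta> F u) / (\<alpha> + \<beta>)\<close> times \<open>b - a\<close>, a factor of modulus at most \<open>1\<close>.
  Rounding \<open>q\<close> to a lattice translation adds at most \<open>1\<close> to each coordinate. The resulting radius is
  independent of the direction and of the length.\<close>

lemma strip_in_seg_nbhd:
  assumes "0 \<le> \<alpha>" "0 \<le> \<beta>" and l: "0 \<le> l"
    and r: "2 * norm (lattice_pt a) + 2 * norm (lattice_pt b) < r"
  defines "w \<equiv> \<alpha> *\<^sub>R lattice_pt a + \<beta> *\<^sub>R lattice_pt b"
  shows "\<exists>k. (+) k ` (tri (nat \<lfloor>l * (\<alpha> + \<beta>)\<rfloor>) \<inter> strip \<alpha> \<beta>) \<subseteq> seg_nbhd q l w r"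
proof (intro exI subsetI)
  let ?k = "comb \<lfloor>f q\<rfloor> \<lfloor>g q\<rfloor>"
  define s where "s = \<alpha> + \<beta>"
  fix u' assume "u' \<in> (+) ?k ` (tri (nat \<lfloor>l * (\<alpha> + \<beta>)\<rfloor>) \<inter> strip \<alpha> \<beta>)"
  then obtain u where u': "u' = ?k + u" and u: "u \<in> tri (nat \<lfloor>l * s\<rfloor>)" "u \<in> strip \<alpha> \<beta>"
    by (auto simp: s_def)
  have s0: "0 \<le> s" using assms by (simp add: s_def)
  have "real (nat \<lfloor>l * s\<rfloor>) \<le> l * s" using l s0 by simp
  with u have FG: "0 \<le> F u" "0 \<le> G u" "F u + G u \<le> l * s" by (auto simp: tri_def)
  define t where "t = (F u + G u) / s"
  have t: "0 \<le> t" "t \<le> l" "\<bar>F u - t * \<alpha>\<bar> \<le> 1" "\<bar>G u - t * \<beta>\<bar> \<le> 1"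
  proof -
    show "0 \<le> t" using FG s0 by (simp add: t_def)
    show "t \<le> l"
    proof (cases "s = 0")
      case False
      with s0 FG show ?thesis by (simp add: t_def field_simps)
    qed (use l in \<open>simp add: t_def\<close>)
    have "\<bar>F u - t * \<alpha>\<bar> \<le> 1 \<and> \<bar>G u - t * \<beta>\<bar> \<le> 1"
    proof (cases "s = 0")
      \<comment> \<open>The triangle of size \<open>0\<close> consists of the origin, and \<open>t = 0\<close> as a quotient by zero.\<close>
      case True
      with FG show ?thesis by (simp add: t_def)
    next
      case False
      with s0 have s: "s > 0" by simp
      have "(F u - t * \<alpha>) * s = \<beta> * F u - \<alpha> * G u" "(G u - t * \<beta>) * s = \<alpha> * G u - \<beta> * F u"
        using s by (simp_all add: t_def field_simps) (simp_all add: s_def algebra_simps)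
      moreover have "\<bar>\<alpha> * G u - \<beta> * F u\<bar> \<le> s" "\<bar>\<beta> * F u - \<alpha> * G u\<bar> \<le> s"
        using u(2) assms(1,2) unfolding strip_def s_def mem_Collect_eq by linarith+
      ultimately have "\<bar>(F u - t * \<alpha>) * s\<bar> \<le> s" "\<bar>(G u - t * \<beta>) * s\<bar> \<le> s" by simp_all
      with s show ?thesis by (simp add: abs_mult)
    qed
    thus "\<bar>F u - t * \<alpha>\<bar> \<le> 1" "\<bar>G u - t * \<beta>\<bar> \<le> 1" by auto
  qed
  define x where "x = of_int \<lfloor>f q\<rfloor> - f q + (F u - t * \<alpha>)"
  define y where "y = of_int \<lfloor>g q\<rfloor> - g q + (G u - t * \<beta>)"
  have xy: "\<bar>x\<bar> \<le> 2" "\<bar>y\<bar> \<le> 2" using t unfolding x_def y_def by linarith+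
  have "lattice_pt u' - (q + t *\<^sub>R w) =
     (of_int \<lfloor>f q\<rfloor> *\<^sub>R lattice_pt a + of_int \<lfloor>g q\<rfloor> *\<^sub>R lattice_pt b)
     + (F u *\<^sub>R lattice_pt a + G u *\<^sub>R lattice_pt b)
     - ((f q *\<^sub>R lattice_pt a + g q *\<^sub>R lattice_pt b) + t *\<^sub>R w)"
    using coords[of q] coords[of "lattice_pt u"] by (simp add: u' lattice_pt_add lattice_pt_comb)
  also have "\<dots> = x *\<^sub>R lattice_pt a + y *\<^sub>R lattice_pt b"
    by (simp add: x_def y_def w_def algebra_simps)
  finally have "norm (lattice_pt u' - (q + t *\<^sub>R w)) \<le> \<bar>x\<bar> * norm (lattice_pt a) + \<bar>y\<bar> * norm (lattice_pt b)"
    using norm_triangle_ineq[of "x *\<^sub>R lattice_pt a" "y *\<^sub>R lattice_pt b"] by simp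
  also have "\<dots> \<le> 2 * norm (lattice_pt a) + 2 * norm (lattice_pt b)"
    using xy by (intro add_mono mult_right_mono) auto
  finally show "u' \<in> seg_nbhd q l w r" using r t by (auto simp: seg_nbhd_def dist_norm)
qed

text \<open>The thickened segment is squeezed between triangles of sizes \<open>\<lfloor>n (\<alpha> + \<beta>)\<rfloor>\<close> and
  \<open>\<lceil>n (\<alpha> + \<beta>)\<rceil> + C\<close>: it contains a set that codes the former, and it is contained in the latter.\<close>

lemma seg_nbhd_entropy:
  assumes \<alpha>\<beta>: "0 \<le> \<alpha>" "0 \<le> \<beta>"
    and L: "(\<lambda>N. tri_entropy N / real N) \<longlonglongrightarrow> L"
    and r: "2 * norm (lattice_pt a) + 2 * norm (lattice_pt b) < r"
  defines "w \<equiv> \<alpha> *\<^sub>R lattice_pt a + \<beta> *\<^sub>R lattice_pt b"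
  shows "(\<lambda>n. ln (real (block_count X (seg_nbhd (q n) (real n) w r))) / real n) \<longlonglongrightarrow> (\<alpha> + \<beta>) * L"
proof -
  define s where "s = \<alpha> + \<beta>"
  have s0: "0 \<le> s" using \<alpha>\<beta> by (simp add: s_def)
  obtain C where C: "\<And>q l. \<exists>k. seg_nbhd q l w r \<subseteq> (+) k ` tri (nat \<lceil>l * s\<rceil> + C)"
    using seg_nbhd_in_tri[OF \<alpha>\<beta>, of r] by (auto simp: w_def s_def)
  have fin: "finite (seg_nbhd (q n) (real n) w r)" for n
    using C[of "q n" "real n"] finite_subset finite_tri by blast
  have pos: "0 < block_count X A" if "finite A" for A using block_count_ge_1[OF that] by simp
  have upper: "ln (real (block_count X (seg_nbhd (q n) (real n) w r))) \<le> tri_entropy (nat \<lceil>real n * s\<rceil> + C)" for n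
  proof -
    obtain k where k: "seg_nbhd (q n) (real n) w r \<subseteq> (+) k ` tri (nat \<lceil>real n * s\<rceil> + C)" using C by blast
    have "block_count X (seg_nbhd (q n) (real n) w r) \<le> block_count X ((+) k ` tri (nat \<lceil>real n * s\<rceil> + C))"
      by (intro block_count_mono determines_subset k) (simp add: finite_tri)
    thus ?thesis
      unfolding tri_entropy_def block_count_translate[OF finite_tri]
      using pos[OF fin] pos[OF finite_tri] by (intro iffD2[OF ln_le_cancel_iff]) auto
  qed
  have lower: "tri_entropy (nat \<lfloor>real n * s\<rfloor>) \<le> ln (real (block_count X (seg_nbhd (q n) (real n) w r)))" for n
  proof -
    let ?S = "tri (nat \<lfloor>real n * s\<rfloor>) \<inter> strip \<alpha> \<beta>"
    have finS: "finite ?S" using finite_tri by simp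
    obtain k where k: "(+) k ` ?S \<subseteq> seg_nbhd (q n) (real n) w r"
      using strip_in_seg_nbhd[OF \<alpha>\<beta> _ r, of "real n" "q n"] by (auto simp: w_def s_def)
    have "block_count X (tri (nat \<lfloor>real n * s\<rfloor>)) \<le> block_count X ?S"
      by (rule block_count_mono[OF finS strip_determines_tri[OF \<alpha>\<beta>]])
    also have "\<dots> = block_count X ((+) k ` ?S)" by (rule block_count_translate[OF finS, symmetric])
    also have "\<dots> \<le> block_count X (seg_nbhd (q n) (real n) w r)"
      by (intro block_count_mono determines_subset k fin)
    finally show ?thesis
      unfolding tri_entropy_def
      using pos[OF fin] pos[OF finite_tri] by (intro iffD2[OF ln_le_cancel_iff]) auto
  qed
  have k1: "(\<lambda>n. real (nat \<lfloor>real n * s\<rfloor>) / real n) \<longlonglongrightarrow> s"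
  proof (rule tendsto_sandwich)
    show "(\<lambda>n. s - 1 / real n) \<longlonglongrightarrow> s"
      using tendsto_diff[OF tendsto_const lim_const_over_n[of "1::real"], of s] by simp
    show "eventually (\<lambda>n. s - 1 / real n \<le> real (nat \<lfloor>real n * s\<rfloor>) / real n) sequentially"
      using eventually_gt_at_top[of 0]
    proof eventually_elim
      case (elim n)
      have "s - 1 / real n = (real n * s - 1) / real n" using elim by (simp add: field_simps)
      also have "\<dots> \<le> real (nat \<lfloor>real n * s\<rfloor>) / real n" by (intro divide_right_mono) linarith+
      finally show ?case .
    qed
    show "eventually (\<lambda>n. real (nat \<lfloor>real n * s\<rfloor>) / real n \<le> s) sequentially"
      using eventually_gt_at_top[of 0] by eventually_elim (use s0 in \<open>simp add: field_simps\<close>)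
  qed simp
  have k2: "(\<lambda>n. real (nat \<lceil>real n * s\<rceil> + C) / real n) \<longlonglongrightarrow> s"
  proof (rule tendsto_sandwich)
    show "(\<lambda>n::nat. s) \<longlonglongrightarrow> s" by simp
    show "(\<lambda>n. s + (real C + 1) / real n) \<longlonglongrightarrow> s"
      using tendsto_add[OF tendsto_const lim_const_over_n[of "real C + 1"], of s] by simp
    show "eventually (\<lambda>n. real (nat \<lceil>real n * s\<rceil> + C) / real n \<le> s + (real C + 1) / real n) sequentially"
      using eventually_gt_at_top[of 0]
    proof eventually_elim
      case (elim n)
      have "0 \<le> real n * s" using s0 by simp
      hence "real (nat \<lceil>real n * s\<rceil> + C) / real n \<le> (real n * s + (real C + 1)) / real n"
        by (intro divide_right_mono; (linarith | simp))
      also have "\<dots> = s + (real C + 1) / real n" using elim by (simp add: field_simps)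
      finally show ?case .
    qed
    show "eventually (\<lambda>n. s \<le> real (nat \<lceil>real n * s\<rceil> + C) / real n) sequentially"
      using eventually_gt_at_top[of 0]
    proof eventually_elim
      case (elim n)
      have "real n * s \<le> real (nat \<lceil>real n * s\<rceil> + C)" by linarith
      with elim show ?case by (simp add: field_simps)
    qed
  qed
  show ?thesis
    unfolding s_def[symmetric]
    by (rule tendsto_sandwich[OF _ _ growth_rate_along_index[OF L k1] growth_rate_along_index[OF L k2]])
       (use upper lower in \<open>auto intro!: always_eventually divide_right_mono\<close>)
qed

lemma entropy_in_cone:
  "\<exists>L\<ge>0. cone_rate X (lattice_pt a) (lattice_pt b) L"
proof -
  obtain L where L: "L \<ge> 0" "(\<lambda>N. tri_entropy N / real N) \<longlonglongrightarrow> L" using tri_entropy_rate by blast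
  have "entropy_seminorm X v = (\<alpha> + \<beta>) * L"
    if \<alpha>\<beta>: "0 \<le> \<alpha>" "0 \<le> \<beta>" and w: "w = \<alpha> *\<^sub>R lattice_pt a + \<beta> *\<^sub>R lattice_pt b" and v: "v = w \<or> v = - w"
    for \<alpha> \<beta> v w
  proof -
    define q where "q n = (if v = w then 0 else - (real n *\<^sub>R w))" for n
    have *: "lim (\<lambda>n. ln (real (pattern_count X (lattice_nbhd ((\<lambda>p. real n *\<^sub>R p) ` (\<lambda>t. t *\<^sub>R v) ` {0..1}) r))) / real n)
           = (\<alpha> + \<beta>) * L"
      if r: "2 * norm (lattice_pt a) + 2 * norm (lattice_pt b) < r" for r
    proof (rule limI)
      have "{u. lattice_pt u \<in> lattice_nbhd ((\<lambda>p. real n *\<^sub>R p) ` (\<lambda>t. t *\<^sub>R v) ` {0..1}) r}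
           = seg_nbhd (q n) (real n) w r" for n
        by (rule lattice_nbhd_segment) (use v in \<open>auto simp: q_def\<close>)
      thus "(\<lambda>n. ln (real (pattern_count X (lattice_nbhd ((\<lambda>p. real n *\<^sub>R p) ` (\<lambda>t. t *\<^sub>R v) ` {0..1}) r))) / real n)
           \<longlonglongrightarrow> (\<alpha> + \<beta>) * L"
        unfolding pattern_count_eq_block_count
        using seg_nbhd_entropy[OF \<alpha>\<beta> L(2) r, of q] by (simp add: w)
    qed
    show ?thesis
      unfolding entropy_seminorm_def directional_entropy_def polygon_entropy_def
      by (rule tendsto_Lim[OF trivial_limit_at_top_linorder], rule tendsto_eventually,
          rule eventually_mono[OF eventually_gt_at_top *])
  qed
  hence "cone_rate X (lattice_pt a) (lattice_pt b) L" unfolding cone_rate_def by blast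
  with L(1) show ?thesis by blast
qed

end

section \<open>The seminorm of a triangular subshift\<close>

text \<open>Translating by \<open>- p\<close> puts the vertex \<open>p\<close> of \<open>T\<close> at the origin; shift invariance carries the coding of
  the other two vertices along.\<close>

lemma entropy_in_vertex_cone:
  fixes p q s :: "int \<times> int"
  assumes X: "nonempty_subshift \<A> X"
    and nc: "\<not> collinear {lattice_pt p, lattice_pt q, lattice_pt s}"
    and T: "T = convex hull {lattice_pt p, lattice_pt q, lattice_pt s}"
    and cod: "\<And>v. v \<in> {lattice_pt q, lattice_pt s} \<Longrightarrow> codes X (T - {v}) {v}"
  shows "\<exists>L\<ge>0. cone_rate X (lattice_pt q - lattice_pt p) (lattice_pt s - lattice_pt p) L"
proof -
  interpret nonempty_subshift \<A> X by (rule X)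
  define a b where "a = q - p" and "b = s - p"
  have ab: "lattice_pt a = lattice_pt q - lattice_pt p" "lattice_pt b = lattice_pt s - lattice_pt p"
    by (simp_all add: a_def b_def lattice_pt_diff)
  have "\<not> collinear {0, lattice_pt a, lattice_pt b}"
    using nc unfolding ab by (subst (asm) collinear_diffs)
  then obtain f g where fg: "linear f" "linear g" "\<And>z. z = f z *\<^sub>R lattice_pt a + g z *\<^sub>R lattice_pt b"
    "f (lattice_pt a) = 1" "g (lattice_pt a) = 0" "f (lattice_pt b) = 0" "g (lattice_pt b) = 1"
    by (rule linear_coordinates) blast
  let ?H = "{w. 0 \<le> f (lattice_pt w) \<and> 0 \<le> g (lattice_pt w) \<and> f (lattice_pt w) + g (lattice_pt w) \<le> 1}"
  have mem: "u - p \<in> ?H" if "lattice_pt u \<in> T" for u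
  proof -
    obtain x y where xy: "lattice_pt u = lattice_pt p + x *\<^sub>R lattice_pt a + y *\<^sub>R lattice_pt b" "0 \<le> x" "0 \<le> y" "x + y \<le> 1"
      using \<open>lattice_pt u \<in> T\<close> unfolding T convex_hull_3_alt by (auto simp: ab)
    have "lattice_pt (u - p) = x *\<^sub>R lattice_pt a + y *\<^sub>R lattice_pt b" by (simp add: lattice_pt_diff xy)
    hence "f (lattice_pt (u - p)) = x" "g (lattice_pt (u - p)) = y"
      by (simp_all add: linear_add[OF fg(1)] linear_add[OF fg(2)] linear_scale[OF fg(1)] linear_scale[OF fg(2)] fg(4-7))
    with xy show ?thesis by simp
  qed
  have corner: "determines X {w. 0 \<le> f (lattice_pt w) \<and> 0 \<le> g (lattice_pt w) \<and>
      f (lattice_pt w) + g (lattice_pt w) \<le> 1 \<and> w \<noteq> c} {c}" (is "determines X ?H' _")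
    if c: "c = a \<or> c = b" for c
    unfolding determines_def
  proof (intro ballI impI)
    fix x x' v assume x: "x \<in> X" "x' \<in> X" and eq: "\<forall>u\<in>?H'. x u = x' u" and "v \<in> {c}"
    define y y' where "y = (\<lambda>u. x (- p + u))" and "y' = (\<lambda>u. x' (- p + u))"
    have y: "y \<in> X" "y' \<in> X" using x by (simp_all only: y_def y'_def shift_in)
    have "lattice_pt (p + c) \<in> {lattice_pt q, lattice_pt s}" using c by (auto simp: a_def b_def)
    from cod[OF this] y
    have "(\<forall>u. lattice_pt u \<in> T - {lattice_pt (p + c)} \<longrightarrow> y u = y' u) \<longrightarrow> y (p + c) = y' (p + c)"
      unfolding codes_def by blast
    moreover have "y u = y' u" if "lattice_pt u \<in> T - {lattice_pt (p + c)}" for u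
    proof -
      have "u - p \<noteq> c" using that by (auto simp: algebra_simps)
      with mem[of u] that eq have "x (u - p) = x' (u - p)" by blast
      thus ?thesis by (simp add: y_def y'_def)
    qed
    ultimately show "x v = x' v" using \<open>v \<in> {c}\<close> by (simp add: y_def y'_def)
  qed
  interpret corner_coded_subshift \<A> X a b f g
    by (rule corner_coded_subshift.intro[OF X corner_coded_subshift_axioms.intro[OF fg
          corner[OF disjI1[OF refl]] corner[OF disjI2[OF refl]]]])
  show ?thesis using entropy_in_cone unfolding ab .
qed

text \<open>For a triangle with edge vectors \<open>a\<close> and \<open>b\<close> at a vertex, this is the size of the smallest homothetic
  copy that contains the segment from \<open>0\<close> to \<open>x a + y b\<close>: the sides of such a copy are given by
  bounds from below on the two coordinates and a bound from above on their sum, and the size is the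
  last bound minus the other two.\<close>

definition triangle_size :: "real \<Rightarrow> real \<Rightarrow> real" where
  "triangle_size x y = max 0 (x + y) + max 0 (- x) + max 0 (- y)"

text \<open>The three vertex cones and their opposites cover the plane. The rates at two vertices agree because
  the edge joining these vertices is, up to sign, an edge vector at both.\<close>

lemma entropy_eq_triangle_size:
  fixes p q s :: "int \<times> int"
  assumes X: "nonempty_subshift \<A> X"
    and nc: "\<not> collinear {lattice_pt p, lattice_pt q, lattice_pt s}"
    and T: "T = convex hull {lattice_pt p, lattice_pt q, lattice_pt s}"
    and cod: "\<And>v. v \<in> {lattice_pt p, lattice_pt q, lattice_pt s} \<Longrightarrow> codes X (T - {v}) {v}"
  shows "\<exists>L\<ge>0. \<forall>x y. entropy_seminorm X
     (x *\<^sub>R (lattice_pt q - lattice_pt p) + y *\<^sub>R (lattice_pt s - lattice_pt p)) = triangle_size x y * L"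
proof -
  define a b where "a = lattice_pt q - lattice_pt p" and "b = lattice_pt s - lattice_pt p"
  obtain L where L0: "L \<ge> 0" and L: "cone_rate X a b L"
    using entropy_in_vertex_cone[OF X nc T] cod unfolding a_def b_def by blast
  have nc2: "\<not> collinear {lattice_pt q, lattice_pt p, lattice_pt s}"
    and T2: "T = convex hull {lattice_pt q, lattice_pt p, lattice_pt s}"
    using nc T by (simp_all add: insert_commute)
  have nc3: "\<not> collinear {lattice_pt s, lattice_pt p, lattice_pt q}"
    and T3: "T = convex hull {lattice_pt s, lattice_pt p, lattice_pt q}"
    using nc T by (simp_all add: insert_commute)
  have ab: "lattice_pt p - lattice_pt q = - a" "lattice_pt s - lattice_pt q = b - a"
    "lattice_pt p - lattice_pt s = - b" "lattice_pt q - lattice_pt s = a - b"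
    by (simp_all add: a_def b_def)
  obtain M where M: "cone_rate X (- a) (b - a) M"
    using entropy_in_vertex_cone[OF X nc2 T2] cod unfolding ab by blast
  obtain K where K: "cone_rate X (- b) (a - b) K"
    using entropy_in_vertex_cone[OF X nc3 T3] cod unfolding ab by blast
  note rate = iffD1[OF cone_rate_def, rule_format]
  have M_eq: "M = L" using rate[OF M, of 1 0 a] rate[OF L, of 1 0 a] by simp
  have K_eq: "K = L" using rate[OF K, of 1 0 b] rate[OF L, of 0 1 b] by simp
  have "entropy_seminorm X (x *\<^sub>R a + y *\<^sub>R b) = triangle_size x y * L" for x y
  proof -
    let ?v = "x *\<^sub>R a + y *\<^sub>R b"
    consider "0 \<le> x" "0 \<le> y" | "x \<le> 0" "y \<le> 0"
      | "0 \<le> x" "y \<le> 0" "0 \<le> x + y" | "0 \<le> x" "y \<le> 0" "x + y \<le> 0"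
      | "x \<le> 0" "0 \<le> y" "0 \<le> x + y" | "x \<le> 0" "0 \<le> y" "x + y \<le> 0" by linarith
    thus ?thesis
    proof cases
      case 1
      with rate[OF L, of x y ?v] show ?thesis by (simp add: triangle_size_def)
    next
      case 2
      with rate[OF L, of "- x" "- y" ?v] show ?thesis by (simp add: triangle_size_def)
    next
      case 3
      with rate[OF M, of "x + y" "- y" ?v] M_eq show ?thesis by (simp add: triangle_size_def algebra_simps)
    next
      case 4
      with rate[OF K, of "- (x + y)" x ?v] K_eq show ?thesis by (simp add: triangle_size_def algebra_simps)
    next
      case 5
      with rate[OF K, of "x + y" "- x" ?v] K_eq show ?thesis by (simp add: triangle_size_def algebra_simps)
    next
      case 6
      with rate[OF M, of "- (x + y)" y ?v] M_eq show ?thesis by (simp add: triangle_size_def algebra_simps)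
    qed
  qed
  thus ?thesis using L0 unfolding a_def b_def by blast
qed

theorem corollary6p9:
  fixes \<A> :: "'a set" and \<B> :: "'b set"
    and X :: "(int \<times> int \<Rightarrow> 'a) set" and Y :: "(int \<times> int \<Rightarrow> 'b) set"
    and T :: "(real \<times> real) set"
  assumes "subshift \<A> X" and "subshift \<B> Y"
    and "triangular X" and "triangular Y"
    and "nontrivial_entropy_seminorm X" and "nontrivial_entropy_seminorm Y"
    and "2 simplex T"
    and "polygonal_wrt X T" and "polygonal_wrt Y T"
  shows "\<exists>c>0. \<forall>v. entropy_seminorm X v = c * entropy_seminorm Y v"
proof -
  obtain V where V: "\<not> affine_dependent V" "int (card V) = 2 + 1" "T = convex hull V"
    using \<open>2 simplex T\<close> unfolding simplex by blast
  have ext: "v extreme_point_of T \<longleftrightarrow> v \<in> V" for v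
    unfolding V(3) by (rule extreme_point_of_convex_hull_affine_independent[OF V(1)])
  have "card V = 3" using V(2) by simp
  then obtain P Q R where PQR: "V = {P, Q, R}" "P \<noteq> Q" "P \<noteq> R" "Q \<noteq> R"
    by (auto simp: card_3_iff)
  have lat: "v \<in> range lattice_pt" if "v \<in> V" for v
    using \<open>polygonal_wrt X T\<close> that ext unfolding polygonal_wrt_def lattice_polygon_def by blast
  obtain p where p: "P = lattice_pt p" using lat[of P] PQR by auto
  obtain q where q: "Q = lattice_pt q" using lat[of Q] PQR by auto
  obtain s where s: "R = lattice_pt s" using lat[of R] PQR by auto
  have nc: "\<not> collinear {lattice_pt p, lattice_pt q, lattice_pt s}"
    using V(1) PQR unfolding collinear_3_eq_affine_dependent by (simp flip: p q s)
  have T: "T = convex hull {lattice_pt p, lattice_pt q, lattice_pt s}"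
    using V(3) PQR(1) by (simp add: p q s)
  have V': "V = {lattice_pt p, lattice_pt q, lattice_pt s}" using PQR(1) by (simp add: p q s)
  have X: "nonempty_subshift \<A> X" and Y: "nonempty_subshift \<B> Y"
    using assms by (auto simp: nonempty_subshift_def polygonal_wrt_def)
  let ?v = "\<lambda>x y. x *\<^sub>R (lattice_pt q - lattice_pt p) + y *\<^sub>R (lattice_pt s - lattice_pt p)"
  obtain L where L: "L \<ge> 0" "\<And>x y. entropy_seminorm X (?v x y) = triangle_size x y * L"
    using entropy_eq_triangle_size[OF X nc T] \<open>polygonal_wrt X T\<close> ext
    unfolding polygonal_wrt_def V' by blast
  obtain M where M: "M \<ge> 0" "\<And>x y. entropy_seminorm Y (?v x y) = triangle_size x y * M"
    using entropy_eq_triangle_size[OF Y nc T] \<open>polygonal_wrt Y T\<close> ext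
    unfolding polygonal_wrt_def V' by blast
  have "\<not> collinear {0, lattice_pt q - lattice_pt p, lattice_pt s - lattice_pt p}"
    using nc by (subst (asm) collinear_diffs)
  then obtain f g :: "real \<times> real \<Rightarrow> real" where v: "\<And>z. z = ?v (f z) (g z)"
    by (rule linear_coordinates) blast
  have entX: "entropy_seminorm X z = triangle_size (f z) (g z) * L" for z
    using L(2)[of "f z" "g z"] by (simp flip: v)
  have entY: "entropy_seminorm Y z = triangle_size (f z) (g z) * M" for z
    using M(2)[of "f z" "g z"] by (simp flip: v)
  have "L \<noteq> 0" "M \<noteq> 0"
    using assms(5,6) by (auto simp: nontrivial_entropy_seminorm_def entX entY)
  with L M have "L / M > 0" "\<And>z. entropy_seminorm X z = L / M * entropy_seminorm Y z"
    by (simp_all add: entX entY)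
  thus ?thesis by blast
qed

end
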